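(* Let $G\in\mathcal{QD}1$ and let $\{e\}$ be a basis of $G$. 1) If $\mathrm{cochar}\,G=(\infty,\infty,\ldots,\infty,\ldots)$ (i.e. $\mathrm{cochar}\,G$ takes the value $\infty$ at every prime), then every ring on $G$ is an $FI$-ring (and, consequently, an $AI$-ring). 2) If $\mathrm{cochar}\,G\neq(\infty,\infty,\ldots,\infty,\ldots)$ and $(G,\times)$ is a ring on $G$, then the following conditions are equivalent: a) $(G,\times)$ is an $FI$-ring; b) $(G,\times)$ is an $AI$-ring; c) $e\times e\notin T(G)$; d) $G\times G\nsubseteq T(G)$.
   Context: All groups are abelian, written additively; $P$ is the set of all primes, $T(G)$ is the torsion part of $G$. A group $G$ is quotient divisible if it contains no nonzero divisible torsion subgroup but contains a free subgroup $F$ of finite rank such that $G/F$ is a divisible torsion group; a basis of the free group $F$ is called a basis of the quotient divisible group $G$. $\mathcal{QD}1$ is the class of all quotient divisible groups of torsion-free rank 1 (so a basis is a single element $\{e\}$ with $\mathbb{Z}e$ infinite cyclic and $G/\mathbb{Z}e$ divisible torsion). Cocharacteristic: a characteristic is a function $\chi:P\to\{0,1,2,\ldots,\infty\}$. Every $G\in\mathcal{QD}1$ is determined up to isomorphism by a characteristic $\mathrm{cochar}\,G$, and every characteristic $\chi$ occurs, as follows. If $\chi$ takes only finite values and $\chi(p)=0$ for all but finitely many $p$ ($\chi$ belongs to the zero type), the group with $\mathrm{cochar}\,G=\chi$ is $\mathbb{Q}\oplus\mathbb{Z}_m$ with $m=\prod_{\chi(p)\ne0}p^{\chi(p)}$,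 where $\mathbb{Z}_m$ is cyclic of order $m$. Otherwise, let $\mathbb{Z}_\chi=\prod_{p\in P}\widehat{\mathbb{Z}}_pe_p$, where $\widehat{\mathbb{Z}}_p$ is the ring of $p$-adic integers and $\widehat{\mathbb{Z}}_pe_p$ is the cyclic $\widehat{\mathbb{Z}}_p$-module whose generator $e_p$ has order $p^{\chi(p)}$ (with $p^\infty=\infty$); then the group with $\mathrm{cochar}\,G=\chi$ is the pure subgroup $\langle e,T(\mathbb{Z}_\chi)\rangle_*$ of $\mathbb{Z}_\chi$ generated by $e=(e_p)_{p\in P}$ and the torsion part $T(\mathbb{Z}_\chi)$, i.e. the set of all $x\in\mathbb{Z}_\chi$ with $nx\in\mathbb{Z}e+T(\mathbb{Z}_\chi)$ for some integer $n\ge1$. A multiplication on $G$ is a homomorphism $\mu:G\otimes G\to G$, written $g_1\times g_2=\mu(g_1\otimes g_2)$; a ring $(G,\times)$ on $G$ is $G$ equipped with a multiplication $\times$ (associativity, commutativity and a unit are not required). $G\times G$ is the subgroup generated by all products. An absolute ideal of $G$ is a subgroup of $G$ that is an ideal in every ring on $G$. A subgroup is fully invariant if it is mapped into itself by every endomorphism of $G$. A ring $R$ is an $AI$-ring (respectively, an $FI$-ring) if every ideal of $R$ is an absolute ideal (respectively, a fully invariant subgroup) of the additive group of $R$. *)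

theory Defs
  imports
    "HOL-Algebra.QuotRing"
    "HOL-Algebra.Product_Groups"
    "HOL-Computational_Algebra.Primes"
    "HOL-Library.Extended_Nat"
begin

text \<open>Abelian groups are the commutative groups of HOL-Algebra. These are written
  multiplicatively, so \<open>x \<otimes> y\<close> is the sum \<open>x + y\<close>, \<open>x [^] n\<close> is \<open>n x\<close>, and \<open>\<one>\<close> is \<open>0\<close>.\<close>

definition torsion_part :: "('a, 'b) monoid_scheme \<Rightarrow> 'a set"
  where "torsion_part G = {x \<in> carrier G. \<exists>n::nat. n > 0 \<and> x [^]\<^bsub>G\<^esub> n = \<one>\<^bsub>G\<^esub>}"

definition torsion_group :: "('a, 'b) monoid_scheme \<Rightarrow> bool"
  where "torsion_group G \<longleftrightarrow> torsion_part G = carrier G"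

definition divisible_group :: "('a, 'b) monoid_scheme \<Rightarrow> bool"
  where "divisible_group G \<longleftrightarrow>
    (\<forall>x \<in> carrier G. \<forall>n::nat. n > 0 \<longrightarrow> (\<exists>y \<in> carrier G. y [^]\<^bsub>G\<^esub> n = x))"

text \<open>\<open>indep G B\<close>: the finite set \<open>B\<close> is linearly independent over the integers, i.e. the
  subgroup generated by \<open>B\<close> is free with basis \<open>B\<close>.\<close>

definition indep :: "('a, 'b) monoid_scheme \<Rightarrow> 'a set \<Rightarrow> bool"
  where "indep G B \<longleftrightarrow> finite B \<and> B \<subseteq> carrier G \<and>
    (\<forall>c :: 'a \<Rightarrow> int. (\<Otimes>\<^bsub>G\<^esub>b\<in>B. b [^]\<^bsub>G\<^esub> c b) = \<one>\<^bsub>G\<^esub> \<longrightarrow> (\<forall>b\<in>B. c b = 0))"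

definition torsion_free_rank :: "('a, 'b) monoid_scheme \<Rightarrow> enat"
  where "torsion_free_rank G = (SUP B \<in> {B. indep G B}. enat (card B))"

definition qd_basis :: "('a, 'b) monoid_scheme \<Rightarrow> 'a set \<Rightarrow> bool"
  where "qd_basis G B \<longleftrightarrow> indep G B \<and>
    divisible_group (G Mod generate G B) \<and> torsion_group (G Mod generate G B)"

definition quotient_divisible :: "('a, 'b) monoid_scheme \<Rightarrow> bool"
  where "quotient_divisible G \<longleftrightarrow> comm_group G \<and>
    (\<forall>D. subgroup D G \<and> divisible_group (G\<lparr>carrier := D\<rparr>) \<and> torsion_group (G\<lparr>carrier := D\<rparr>)
      \<longrightarrow> D = {\<one>\<^bsub>G\<^esub>}) \<and>
    (\<exists>B. qd_basis G B)"

definition QD1 :: "('a, 'b) monoid_scheme \<Rightarrow> bool"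
  where "QD1 G \<longleftrightarrow> quotient_divisible G \<and> torsion_free_rank G = 1"


text \<open>The ring of \<open>p\<close>-adic integers as the inverse limit of the rings of integers modulo \<open>p ^ n\<close>,
  each with the representatives \<open>{0..<p ^ n}\<close>.\<close>

definition padic_int :: "nat \<Rightarrow> (nat \<Rightarrow> int) ring"
  where "padic_int p =
    \<lparr>carrier = {x. \<forall>n. x n \<in> {0..<int p ^ n} \<and> x (Suc n) mod int p ^ n = x n},
     monoid.mult = (\<lambda>x y n. (x n * y n) mod int p ^ n),
     one = (\<lambda>n. 1 mod int p ^ n),
     zero = (\<lambda>n. 0),
     add = (\<lambda>x y n. (x n + y n) mod int p ^ n)\<rparr>"

text \<open>The annihilator of an element of order \<open>p ^ k\<close>; for \<open>k = \<infinity>\<close> it is the zero ideal.\<close>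

definition order_ideal :: "nat \<Rightarrow> enat \<Rightarrow> (nat \<Rightarrow> int) set"
  where "order_ideal p k = (case k of
      enat j \<Rightarrow> PIdl\<^bsub>padic_int p\<^esub> (\<lambda>n. int p ^ j mod int p ^ n)
    | \<infinity> \<Rightarrow> {\<zero>\<^bsub>padic_int p\<^esub>})"

text \<open>The cyclic module over the \<open>p\<close>-adic integers with a generator of order \<open>p ^ k\<close> is the
  quotient by that annihilator; its generator is the residue class \<open>\<one>\<close>.\<close>

definition padic_cyclic :: "nat \<Rightarrow> enat \<Rightarrow> (nat \<Rightarrow> int) set ring"
  where "padic_cyclic p k = padic_int p Quot order_ideal p k"

text \<open>A characteristic is a function \<open>\<chi> :: nat \<Rightarrow> enat\<close>, of which only the values at primes are
  used: everything below is independent of the values elsewhere.\<close>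

definition zero_type :: "(nat \<Rightarrow> enat) \<Rightarrow> bool"
  where "zero_type \<chi> \<longleftrightarrow> (\<forall>p. prime p \<longrightarrow> \<chi> p \<noteq> \<infinity>) \<and> finite {p. prime p \<and> \<chi> p \<noteq> 0}"

definition rat_group :: "rat monoid"
  where "rat_group = \<lparr>carrier = UNIV, monoid.mult = (+), one = 0\<rparr>"

definition zero_type_group :: "(nat \<Rightarrow> enat) \<Rightarrow> (rat \<times> int) monoid"
  where "zero_type_group \<chi> =
    rat_group \<times>\<times> integer_mod_group (\<Prod>p | prime p \<and> \<chi> p \<noteq> 0. p ^ the_enat (\<chi> p))"

definition Z_char :: "(nat \<Rightarrow> enat) \<Rightarrow> (nat \<Rightarrow> (nat \<Rightarrow> int) set) monoid"
  where "Z_char \<chi> = product_group {p. prime p} (\<lambda>p. add_monoid (padic_cyclic p (\<chi> p)))"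

definition Z_char_gen :: "(nat \<Rightarrow> enat) \<Rightarrow> nat \<Rightarrow> (nat \<Rightarrow> int) set"
  where "Z_char_gen \<chi> = (\<lambda>p \<in> {p. prime p}. \<one>\<^bsub>padic_cyclic p (\<chi> p)\<^esub>)"

definition nonzero_type_group :: "(nat \<Rightarrow> enat) \<Rightarrow> (nat \<Rightarrow> (nat \<Rightarrow> int) set) monoid"
  where "nonzero_type_group \<chi> = (Z_char \<chi>)
    \<lparr>carrier := {x \<in> carrier (Z_char \<chi>). \<exists>n::nat. n > 0 \<and>
       x [^]\<^bsub>Z_char \<chi>\<^esub> n \<in>
         generate (Z_char \<chi>) {Z_char_gen \<chi>} <#>\<^bsub>Z_char \<chi>\<^esub> torsion_part (Z_char \<chi>)}\<rparr>"

text \<open>\<open>has_cochar G \<chi>\<close> means \<open>cochar G = \<chi>\<close> (as functions on the primes). It is a relation because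
  the cocharacteristic of \<open>G\<close> is given by the isomorphism type of \<open>G\<close>.\<close>

definition has_cochar :: "('a, 'b) monoid_scheme \<Rightarrow> (nat \<Rightarrow> enat) \<Rightarrow> bool"
  where "has_cochar G \<chi> \<longleftrightarrow>
    (if zero_type \<chi> then G \<cong> zero_type_group \<chi> else G \<cong> nonzero_type_group \<chi>)"


text \<open>A multiplication on \<open>G\<close>, i.e. a homomorphism from the tensor square of \<open>G\<close> to \<open>G\<close>, is given by
  the corresponding biadditive map.\<close>

definition multiplication_on :: "('a, 'b) monoid_scheme \<Rightarrow> ('a \<Rightarrow> 'a \<Rightarrow> 'a) \<Rightarrow> bool"
  where "multiplication_on G \<mu> \<longleftrightarrow>
    (\<forall>x \<in> carrier G. (\<lambda>y. \<mu> x y) \<in> hom G G \<and> (\<lambda>y. \<mu> y x) \<in> hom G G)"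

definition product_subgroup :: "('a, 'b) monoid_scheme \<Rightarrow> ('a \<Rightarrow> 'a \<Rightarrow> 'a) \<Rightarrow> 'a set"
  where "product_subgroup G \<mu> = generate G {\<mu> x y | x y. x \<in> carrier G \<and> y \<in> carrier G}"

definition ideal_of :: "('a, 'b) monoid_scheme \<Rightarrow> ('a \<Rightarrow> 'a \<Rightarrow> 'a) \<Rightarrow> 'a set \<Rightarrow> bool"
  where "ideal_of G \<mu> I \<longleftrightarrow> subgroup I G \<and>
    (\<forall>a \<in> I. \<forall>x \<in> carrier G. \<mu> a x \<in> I \<and> \<mu> x a \<in> I)"

definition absolute_ideal :: "('a, 'b) monoid_scheme \<Rightarrow> 'a set \<Rightarrow> bool"
  where "absolute_ideal G I \<longleftrightarrow> subgroup I G \<and>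
    (\<forall>\<mu>. multiplication_on G \<mu> \<longrightarrow> ideal_of G \<mu> I)"

definition fully_invariant :: "('a, 'b) monoid_scheme \<Rightarrow> 'a set \<Rightarrow> bool"
  where "fully_invariant G I \<longleftrightarrow> subgroup I G \<and> (\<forall>\<phi> \<in> hom G G. \<phi> ` I \<subseteq> I)"

definition AI_ring :: "('a, 'b) monoid_scheme \<Rightarrow> ('a \<Rightarrow> 'a \<Rightarrow> 'a) \<Rightarrow> bool"
  where "AI_ring G \<mu> \<longleftrightarrow> (\<forall>I. ideal_of G \<mu> I \<longrightarrow> absolute_ideal G I)"

definition FI_ring :: "('a, 'b) monoid_scheme \<Rightarrow> ('a \<Rightarrow> 'a \<Rightarrow> 'a) \<Rightarrow> bool"
  where "FI_ring G \<mu> \<longleftrightarrow> (\<forall>I. ideal_of G \<mu> I \<longrightarrow> fully_invariant G I)"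

end

theory Submission
  imports Defs
begin

text \<open>
  The group is written additively here: \<open>k x\<close> stands for \<open>x [^] k\<close>. Two properties of \<open>G\<close> carry the
  whole proof. First, \<open>G = \<int>e + mG\<close> for every \<open>m > 0\<close>, because \<open>G/\<int>e\<close> is divisible. Second, an
  endomorphism of \<open>G\<close> is determined by its value at \<open>e\<close> (\<open>hom_ext\<close>): if it vanishes at \<open>e\<close>, it
  factors through the divisible torsion group \<open>G/\<int>e\<close>, so its image is divisible torsion, hence zero.
  In particular a multiplication is determined by \<open>e \<times> e\<close>, which gives the equivalence of
  \<open>e \<times> e \<notin> T(G)\<close> and \<open>G \<times> G \<not>\<subseteq> T(G)\<close>: if \<open>m(e \<times> e) = 0\<close>, then \<open>m(x \<times> y) = 0\<close> for all
  \<open>x\<close> and \<open>y\<close>.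

  Suppose that \<open>h = e \<times> e\<close> is not torsion, so that \<open>n h = k e\<close> with \<open>n, k \<noteq> 0\<close>. Then
  \<open>n (y \<times> e) = k y\<close> for all \<open>y\<close>, as both sides agree at \<open>e\<close>. Given an endomorphism \<open>\<phi>\<close>, write
  \<open>\<phi>(e) = a e + k g = a e + n (g \<times> e)\<close>. Again both sides of \<open>\<phi>(x) = a x + n (g \<times> x)\<close> agree at
  \<open>x = e\<close>, so this holds for all \<open>x\<close>, and its right-hand side stays in every ideal containing \<open>x\<close>.
  Thus the ring is an FI-ring (\<open>FI_ring_if_nontorsion\<close>). Every FI-ring is an AI-ring, as left and
  right multiplications are endomorphisms.

  Suppose on the contrary that \<open>m(e \<times> e) = 0\<close> with \<open>m > 0\<close>. Then every subgroup of \<open>mG\<close> is an ideal,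
  in particular \<open>\<int>me\<close>. There is another multiplication \<open>\<nu>\<close> on \<open>G\<close> with \<open>\<nu>(g, e) = g\<close>
  (\<open>unital_multiplication_exists\<close>). If \<open>\<int>me\<close> is an absolute ideal, then it contains
  \<open>\<nu>(g, me) = mg\<close> for all \<open>g\<close>, so \<open>mG \<subseteq> \<int>e\<close> and \<open>G = \<int>e + mG = \<int>e\<close>. Hence an AI-ring on
  a noncyclic \<open>G\<close> satisfies \<open>e \<times> e \<notin> T(G)\<close>.

  The main work is the existence of \<open>\<nu>\<close>, that is, of an endomorphism of \<open>G\<close> with a prescribed value
  at \<open>e\<close>. It rests on the fact that, for every \<open>n > 0\<close>, some multiple \<open>MG\<close> meets the \<open>n\<close>-torsion of
  \<open>G\<close> trivially (\<open>torsion_separated\<close>).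

  Finally, the group of cocharacteristic \<open>(\<infinity>, \<infinity>, \<dots>)\<close> is infinite cyclic, since a family of \<open>p\<close>-adic
  integers which is a rational number is an integer (\<open>padic_family_integer\<close>). So the two parts
  of the theorem are the cyclic case, where every subgroup is fully invariant, and the noncyclic case.
\<close>

section \<open>Pointwise operations on endomorphisms of a commutative group\<close>

lemma (in comm_group) m_swap:
  "\<lbrakk>a \<in> carrier G; b \<in> carrier G; c \<in> carrier G; d \<in> carrier G\<rbrakk>
    \<Longrightarrow> (a \<otimes> b) \<otimes> (c \<otimes> d) = (a \<otimes> c) \<otimes> (b \<otimes> d)"
  by (simp add: m_ac)

lemma (in comm_group) mult_inv_exchange:
  assumes "a \<in> carrier G" "b \<in> carrier G" "c \<in> carrier G" "d \<in> carrier G" "b \<otimes> c = a \<otimes> d"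
  shows "inv a \<otimes> b = d \<otimes> inv c"
proof -
  have "inv a \<otimes> b = inv a \<otimes> (b \<otimes> c) \<otimes> inv c"
    using assms(1-4) by (simp add: m_assoc)
  also have "\<dots> = d \<otimes> inv c"
    using assms by (simp add: m_assoc[symmetric])
  finally show ?thesis .
qed

lemma (in comm_group) hom_mult_hom:
  assumes "f \<in> hom G G" "g \<in> hom G G"
  shows "(\<lambda>x. f x \<otimes> g x) \<in> hom G G"
proof (rule homI)
  fix x y assume "x \<in> carrier G" "y \<in> carrier G"
  then show "f (x \<otimes> y) \<otimes> g (x \<otimes> y) = f x \<otimes> g x \<otimes> (f y \<otimes> g y)"
    using assms by (simp add: hom_mult hom_in_carrier m_swap)
qed (use assms in \<open>simp add: hom_in_carrier\<close>)

lemma (in comm_group) hom_pow_hom: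
  assumes "f \<in> hom G G"
  shows "(\<lambda>x. f x [^] (k::int)) \<in> hom G G"
  by (rule homI) (use assms in \<open>simp_all add: hom_in_carrier hom_mult int_pow_distrib\<close>)

lemma (in comm_group) id_hom: "(\<lambda>x. x) \<in> hom G G"
  by (simp add: homI)

section \<open>Endomorphisms are determined by their value at the basis element\<close>

text \<open>
  A quotient divisible group with basis \<open>{e}\<close>, with the conditions on \<open>G/\<int>e\<close> spelled out for
  elements of \<open>G\<close>. All exponents are integers, so that multiples can be subtracted freely.
\<close>
locale qd_rank_one = comm_group G for G (structure) +
  fixes e
  assumes e_closed [simp, intro]: "e \<in> carrier G"
    and e_free: "e [^] (k::int) = \<one> \<Longrightarrow> k = 0"
    and torsion_mod_e: "x \<in> carrier G \<Longrightarrow> \<exists>(n::int) (k::int). n > 0 \<and> x [^] n = e [^] k"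
    and divisible_mod_e:
      "\<lbrakk>x \<in> carrier G; n > 0\<rbrakk> \<Longrightarrow> \<exists>a::int. \<exists>z \<in> carrier G. x = e [^] a \<otimes> z [^] (n::int)"
    and reduced:
      "\<lbrakk>subgroup D G; \<And>x n. x \<in> D \<Longrightarrow> n > 0 \<Longrightarrow> \<exists>y \<in> D. y [^] (n::int) = x;
        \<And>x. x \<in> D \<Longrightarrow> \<exists>n::int. n > 0 \<and> x [^] n = \<one>\<rbrakk> \<Longrightarrow> D = {\<one>}"
begin

text \<open>
  The image of such an \<open>f\<close> is an image of \<open>G/\<int>e\<close>, hence divisible torsion.
\<close>
lemma hom_trivial:
  assumes f: "f \<in> hom G G" and fe: "f e = \<one>" and x: "x \<in> carrier G"
  shows "f x = \<one>"
proof -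
  interpret f: group_hom G G f
    using f is_group by (simp add: group_hom_def group_hom_axioms_def)
  have "f ` carrier G = {\<one>}"
  proof (rule reduced)
    show "subgroup (f ` carrier G) G"
      by (rule f.img_is_subgroup)
  next
    fix y and n :: int
    assume "y \<in> f ` carrier G" and n: "n > 0"
    then obtain x where x: "x \<in> carrier G" "y = f x" by blast
    obtain a z where z: "z \<in> carrier G" "x = e [^] (a::int) \<otimes> z [^] n"
      using divisible_mod_e[OF x(1) n] by blast
    then have "y = f z [^] n"
      using x fe by (simp add: f.hom_int_pow)
    then show "\<exists>y' \<in> f ` carrier G. y' [^] n = y"
      using z by blast
  next
    fix y
    assume "y \<in> f ` carrier G"
    then obtain x where x: "x \<in> carrier G" "y = f x" by blast
    obtain n k :: int where n: "n > 0" "x [^] n = e [^] k"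
      using torsion_mod_e[OF x(1)] by blast
    then have "y [^] n = \<one>"
      using x fe f.hom_int_pow[OF x(1), of n] f.hom_int_pow[OF e_closed, of k] by simp
    then show "\<exists>n::int. n > 0 \<and> y [^] n = \<one>"
      using n by blast
  qed
  then show ?thesis using x by blast
qed

lemma hom_ext:
  assumes f: "f \<in> hom G G" and g: "g \<in> hom G G" and eq: "f e = g e" and x: "x \<in> carrier G"
  shows "f x = g x"
proof -
  have "(\<lambda>x. f x \<otimes> g x [^] (-1::int)) \<in> hom G G"
    by (intro hom_mult_hom hom_pow_hom f g)
  moreover have "f e \<otimes> g e [^] (-1::int) = \<one>"
    using g eq by (simp add: int_pow_neg hom_in_carrier)
  ultimately have "f x \<otimes> g x [^] (-1::int) = \<one>"
    using x by (rule hom_trivial)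
  then have "f x \<otimes> inv (g x) = \<one>"
    using x g by (simp add: int_pow_neg hom_in_carrier)
  then show ?thesis
    using x f g by (metis hom_in_carrier inv_closed inv_equality inv_inv)
qed

section \<open>Separating torsion from multiples\<close>

text \<open>
  Multiplication by a number coprime to \<open>n\<close> is invertible on \<open>n\<close>-primary torsion, and the factors
  that \<open>m\<close> shares with \<open>n\<close> are split off one gcd at a time.
\<close>
lemma divisible_by_if_divisible_primary:
  assumes n: "n > 0" and B: "subgroup B G"
    and div: "\<And>b. b \<in> B \<Longrightarrow> \<exists>c \<in> B. c [^] int n = b"
    and prim: "\<And>b. b \<in> B \<Longrightarrow> \<exists>s. b [^] (int n ^ s) = \<one>"
  shows "m > 0 \<Longrightarrow> b \<in> B \<Longrightarrow> \<exists>c \<in> B. c [^] int m = b"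
proof (induction m arbitrary: b rule: less_induct)
  case (less m)
  have Bc: "\<And>b. b \<in> B \<Longrightarrow> b \<in> carrier G" using B by (simp add: subgroup.mem_carrier)
  have Bp: "\<And>b k. b \<in> B \<Longrightarrow> b [^] (k::int) \<in> B" using B by (simp add: subgroup_int_pow_closed)
  define d where "d = gcd m n"
  show ?case
  proof (cases "d = 1")
    case True
    obtain s where s: "b [^] (int n ^ s) = \<one>" using prim less.prems by blast
    have "coprime (int m) (int n ^ s)"
      using True unfolding d_def coprime_iff_gcd_eq_1[symmetric] by simp
    then obtain u v where uv: "u * int m + v * int n ^ s = 1"
      by (metis bezout_int coprime_imp_gcd_eq_1)
    have "b = b [^] (u * int m + v * int n ^ s)"
      using uv less.prems Bc by simp
    also have "\<dots> = b [^] (u * int m) \<otimes> b [^] (int n ^ s * v)"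
      using less.prems Bc by (simp add: int_pow_mult mult.commute)
    also have "\<dots> = (b [^] u) [^] int m"
      using less.prems Bc s by (simp add: int_pow_pow flip: int_pow_pow[of b "int n ^ s"])
    finally show ?thesis using Bp less.prems by metis
  next
    case False
    obtain m' n' where m': "m = d * m'" and n': "n = d * n'"
      unfolding d_def by (metis dvdE gcd_dvd1 gcd_dvd2)
    have "m' > 0" "m' < m"
      using False less.prems m' by (cases d; auto)+
    obtain b' where b': "b' \<in> B" "b' [^] int n = b" using div less.prems by blast
    obtain c where c: "c \<in> B" "c [^] int m' = b' [^] int n'"
      using less.IH[OF \<open>m' < m\<close> \<open>m' > 0\<close> Bp[OF b'(1)]] by blast
    have "c [^] int m = (c [^] int m') [^] int d"
      using Bc[OF c(1)] m' by (simp only: int_pow_pow of_nat_mult mult.commute)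
    also have "\<dots> = b"
      using c(2) b' Bc[OF b'(1)] n' by (simp only: int_pow_pow of_nat_mult mult.commute)
    finally show ?thesis using c by blast
  qed
qed

text \<open>
  Let \<open>A\<close> be the \<open>n\<close>-primary part of \<open>G\<close>. It is pure, and \<open>G/nG\<close> is generated by the class of \<open>e\<close>, hence
  finite, so \<open>A/nA\<close> is finite as well. A power \<open>M = n ^ K\<close> kills representatives of all its classes, which gives
  \<open>MA = nMA\<close>. So \<open>MA\<close> is divisible torsion, hence zero, and an \<open>n\<close>-torsion element \<open>Mw\<close> is zero because
  \<open>w\<close> lies in \<open>A\<close>.
\<close>
lemma torsion_separated:
  assumes n: "(n::int) > 0"
  shows "\<exists>M>0::int. \<forall>w \<in> carrier G. (w [^] M) [^] n = \<one> \<longrightarrow> w [^] M = \<one>"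
proof -
  define A where "A = {x \<in> carrier G. \<exists>s. x [^] (n ^ s) = \<one>}"
  have Ac: "\<And>x. x \<in> A \<Longrightarrow> x \<in> carrier G" by (simp add: A_def)
  have up: "x [^] (n ^ s) = \<one> \<Longrightarrow> s \<le> t \<Longrightarrow> x [^] (n ^ t) = \<one>" if "x \<in> carrier G" for x s t
    using that by (metis int_pow_one int_pow_pow le_add_diff_inverse power_add)
  have A: "subgroup A G"
  proof (rule subgroupI)
    have "\<one> [^] (n ^ 0) = \<one>" by simp
    then show "A \<noteq> {}" unfolding A_def by blast
  next
    fix x assume "x \<in> A"
    then show "inv x \<in> A" by (auto simp: A_def int_pow_inv)
  next
    fix x y assume "x \<in> A" "y \<in> A"
    then obtain s t where st: "x [^] (n ^ s) = \<one>" "y [^] (n ^ t) = \<one>"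
      and c: "x \<in> carrier G" "y \<in> carrier G" by (auto simp: A_def)
    have "(x \<otimes> y) [^] (n ^ max s t) = \<one>"
      using up[OF c(1) st(1), of "max s t"] up[OF c(2) st(2), of "max s t"] c
      by (simp add: int_pow_distrib)
    then show "x \<otimes> y \<in> A" using c by (auto simp: A_def)
  qed (auto simp: A_def)
  (* The elements of A in the coset of j e modulo nG. *)
  define S where "S j = {x \<in> A. \<exists>z \<in> carrier G. x = e [^] j \<otimes> z [^] n}" for j :: int
  have "\<forall>j. \<exists>k. S j \<noteq> {} \<longrightarrow> (\<exists>r \<in> S j. r [^] (n ^ k) = \<one>)"
    by (auto simp: S_def A_def)
  then obtain kk where kk: "\<And>j. S j \<noteq> {} \<Longrightarrow> \<exists>r \<in> S j. r [^] (n ^ kk j) = \<one>"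
    by metis
  (* Any common upper bound of the exponents would do; the sum avoids a maximum. *)
  define K where "K = (\<Sum>j\<in>{0..<n}. kk j)"
  (* x and the representative r of its class differ by some n c, and c is again in A. *)
  have step: "\<exists>c \<in> A. x [^] (n ^ K) = (c [^] (n ^ K)) [^] n" if x: "x \<in> A" for x
  proof -
    obtain a z where z: "z \<in> carrier G" "x = e [^] (a::int) \<otimes> z [^] n"
      using divisible_mod_e[OF Ac[OF x] n] by blast
    define j where "j = a mod n"
    have "a = j + (a div n) * n" by (simp add: j_def)
    then have "e [^] a = e [^] j \<otimes> (e [^] (a div n)) [^] n"
      by (metis e_closed int_pow_mult int_pow_pow)
    then have xz: "x = e [^] j \<otimes> (e [^] (a div n) \<otimes> z) [^] n"
      using z by (simp add: int_pow_distrib m_assoc)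
    then have "x \<in> S j" using x z by (auto simp: S_def)
    then obtain r where r: "r \<in> S j" "r [^] (n ^ kk j) = \<one>" using kk by blast
    then obtain z' where z': "z' \<in> carrier G" "r = e [^] j \<otimes> z' [^] n" and rA: "r \<in> A"
      by (auto simp: S_def)
    have "j \<in> {0..<n}" using n by (simp add: j_def)
    then have "kk j \<le> K" unfolding K_def by (intro member_le_sum) auto
    then have rK: "r [^] (n ^ K) = \<one>" using up r rA Ac by blast
    define c where "c = (e [^] (a div n) \<otimes> z) \<otimes> inv z'"
    have cc: "c \<in> carrier G" using z z' by (simp add: c_def)
    have "r \<otimes> c [^] n = e [^] j \<otimes> (z' [^] n \<otimes> c [^] n)"
      using z' cc by (simp add: m_assoc)
    also have "z' [^] n \<otimes> c [^] n = (e [^] (a div n) \<otimes> z) [^] n"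
    proof -
      have "z' \<otimes> c = (z' \<otimes> inv z') \<otimes> (e [^] (a div n) \<otimes> z)"
        unfolding c_def using z z' by (subst m_lcomm) (simp_all add: m_comm)
      then show ?thesis using z z' cc by (simp flip: int_pow_distrib)
    qed
    finally have xr: "x = r \<otimes> c [^] n" using xz by simp
    then have "c [^] n = inv r \<otimes> x" using rA Ac cc by (simp add: m_assoc[symmetric])
    then have "c [^] n \<in> A" using A rA x by (simp add: subgroup.m_closed subgroup.m_inv_closed)
    then obtain s where "(c [^] n) [^] (n ^ s) = \<one>" by (auto simp: A_def)
    then have "c [^] (n ^ Suc s) = \<one>" using cc by (simp add: int_pow_pow)
    then have "c \<in> A" using cc unfolding A_def by blast
    moreover have "x [^] (n ^ K) = (c [^] (n ^ K)) [^] n"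
      using xr rK rA Ac cc by (simp add: int_pow_distrib int_pow_pow mult.commute)
    ultimately show ?thesis by blast
  qed
  define B where "B = (\<lambda>x. x [^] (n ^ K)) ` A"
  have BA: "b \<in> A" if "b \<in> B" for b
    using that A by (auto simp: B_def subgroup_int_pow_closed)
  have B: "subgroup B G"
  proof (rule subgroupI)
    show "B \<subseteq> carrier G" using BA Ac by blast
    show "B \<noteq> {}" using A by (auto simp: B_def dest: subgroup.one_closed)
  next
    fix x assume "x \<in> B"
    then obtain y where "y \<in> A" "x = y [^] (n ^ K)" by (auto simp: B_def)
    then show "inv x \<in> B"
      unfolding B_def using A Ac
      by (intro image_eqI[of _ _ "inv y"]) (auto simp: int_pow_inv subgroup.m_inv_closed)
  next
    fix x x' assume "x \<in> B" "x' \<in> B"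
    then obtain y y' where "y \<in> A" "x = y [^] (n ^ K)" "y' \<in> A" "x' = y' [^] (n ^ K)"
      by (auto simp: B_def)
    then show "x \<otimes> x' \<in> B"
      unfolding B_def using A Ac
      by (intro image_eqI[of _ _ "y \<otimes> y'"]) (auto simp: int_pow_distrib subgroup.m_closed)
  qed
  have prim: "\<exists>s. b [^] (int (nat n) ^ s) = \<one>" if "b \<in> B" for b
    using BA[OF that] n by (simp add: A_def)
  have divn: "\<exists>c \<in> B. c [^] int (nat n) = b" if "b \<in> B" for b
    using that step n by (fastforce simp: B_def)
  have "B = {\<one>}"
  proof (rule reduced[OF B])
    fix x and m :: int assume "x \<in> B" "m > 0"
    then show "\<exists>y \<in> B. y [^] m = x"
      using divisible_by_if_divisible_primary[OF _ B divn prim, of "nat m" x] n by simp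
  next
    fix x assume "x \<in> B"
    then obtain s where "x [^] (n ^ s) = \<one>" using BA by (auto simp: A_def)
    then show "\<exists>m::int. m > 0 \<and> x [^] m = \<one>" using n by (intro exI[of _ "n ^ s"]) simp
  qed
  have "w [^] (n ^ K) = \<one>" if w: "w \<in> carrier G" "(w [^] (n ^ K)) [^] n = \<one>" for w
  proof -
    have "w [^] (n ^ Suc K) = \<one>" using w by (simp add: int_pow_pow mult.commute)
    then have "w \<in> A" using w unfolding A_def by blast
    then show ?thesis using \<open>B = {\<one>}\<close> by (auto simp: B_def)
  qed
  then show ?thesis using n by (intro exI[of _ "n ^ K"]) simp
qed

section \<open>Endomorphisms with a prescribed value at the basis element\<close>

text \<open>
  The graph of the endomorphism that sends \<open>e\<close> to \<open>g\<close>. The second condition fixes \<open>n y\<close> where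
  \<open>n x \<in> \<int>e\<close>, so it determines \<open>y\<close> up to torsion; the third one fixes the residue of \<open>y\<close> modulo every
  \<open>mG\<close>, which removes that ambiguity.
\<close>
definition endo_value :: "'a \<Rightarrow> 'a \<Rightarrow> 'a \<Rightarrow> bool" where
  "endo_value g x y \<longleftrightarrow> x \<in> carrier G \<and> y \<in> carrier G \<and>
    (\<exists>(n::int) (k::int). n > 0 \<and> x [^] n = e [^] k \<and> y [^] n = g [^] k) \<and>
    (\<forall>m::int. m > 0 \<longrightarrow> (\<exists>a::int. \<exists>z \<in> carrier G. \<exists>w \<in> carrier G.
       x = e [^] a \<otimes> z [^] m \<and> y = g [^] a \<otimes> w [^] m))"

lemma endo_value_approx:
  assumes "endo_value g x y" "(m::int) > 0"
  obtains a :: int and z w where "z \<in> carrier G" "w \<in> carrier G"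
    "x = e [^] a \<otimes> z [^] m" "y = g [^] a \<otimes> w [^] m"
  using assms unfolding endo_value_def by blast

lemma endo_value_multiple:
  assumes "endo_value g x y"
  obtains n k :: int where "n > 0" "x [^] n = e [^] k" "y [^] n = g [^] k"
  using assms unfolding endo_value_def by blast

lemma endo_value_e:
  assumes "g \<in> carrier G"
  shows "endo_value g e g"
  unfolding endo_value_def
proof (intro conjI allI impI)
  show "\<exists>(n::int) (k::int). n > 0 \<and> e [^] n = e [^] k \<and> g [^] n = g [^] k"
    by (intro exI[of _ 1]) simp
  show "\<exists>a::int. \<exists>z \<in> carrier G. \<exists>w \<in> carrier G. e = e [^] a \<otimes> z [^] m \<and> g = g [^] a \<otimes> w [^] m"
    for m :: int
    using assms by (intro exI[of _ 1] bexI[of _ "\<one>"]) simp_all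
qed (use assms in simp_all)

lemma endo_value_mult:
  assumes g: "g \<in> carrier G" and xy: "endo_value g x y" and xy': "endo_value g x' y'"
  shows "endo_value g (x \<otimes> x') (y \<otimes> y')"
proof -
  have c: "x \<in> carrier G" "x' \<in> carrier G" "y \<in> carrier G" "y' \<in> carrier G"
    using xy xy' by (simp_all add: endo_value_def)
  obtain n k n' k' :: int where nk: "n > 0" "x [^] n = e [^] k" "y [^] n = g [^] k"
    "n' > 0" "x' [^] n' = e [^] k'" "y' [^] n' = g [^] k'"
    using endo_value_multiple[OF xy] endo_value_multiple[OF xy'] by metis
  have *: "(u \<otimes> v) [^] (n * n') = t [^] (k * n' + k' * n)"
    if "u [^] n = t [^] k" "v [^] n' = t [^] k'"
      "t \<in> carrier G" "u \<in> carrier G" "v \<in> carrier G" for t u v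
  proof -
    have "(u \<otimes> v) [^] (n * n') = (u [^] n) [^] n' \<otimes> (v [^] n') [^] n"
      using that(3-) by (simp add: int_pow_distrib int_pow_pow mult.commute)
    then show ?thesis using that by (simp add: int_pow_pow int_pow_mult)
  qed
  have "\<exists>a::int. \<exists>z \<in> carrier G. \<exists>w \<in> carrier G.
       x \<otimes> x' = e [^] a \<otimes> z [^] m \<and> y \<otimes> y' = g [^] a \<otimes> w [^] m" if m: "m > 0" for m :: int
  proof -
    obtain a z w a' z' w' where
      "z \<in> carrier G" "w \<in> carrier G" "x = e [^] (a::int) \<otimes> z [^] m" "y = g [^] a \<otimes> w [^] m"
      "z' \<in> carrier G" "w' \<in> carrier G" "x' = e [^] (a'::int) \<otimes> z' [^] m" "y' = g [^] a' \<otimes> w' [^] m"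
      using endo_value_approx[OF xy m] endo_value_approx[OF xy' m] by metis
    then show ?thesis using g
      by (intro exI[of _ "a + a'"] bexI[of _ "z \<otimes> z'"] bexI[of _ "w \<otimes> w'"])
        (simp_all add: int_pow_mult int_pow_distrib m_swap)
  qed
  moreover have "n * n' > 0" using nk by simp
  ultimately show ?thesis
    unfolding endo_value_def using c *[OF nk(2,5)] *[OF nk(3,6)] g by (auto intro!: exI)
qed

lemma endo_value_inv:
  assumes g: "g \<in> carrier G" and xy: "endo_value g x y"
  shows "endo_value g (inv x) (inv y)"
proof -
  have c: "x \<in> carrier G" "y \<in> carrier G" using xy by (simp_all add: endo_value_def)
  obtain n k :: int where nk: "n > 0" "x [^] n = e [^] k" "y [^] n = g [^] k"
    using endo_value_multiple[OF xy] by metis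
  have "inv x [^] n = e [^] (-k) \<and> inv y [^] n = g [^] (-k)"
    using nk c g by (simp add: int_pow_inv int_pow_neg)
  moreover have "\<exists>a::int. \<exists>z \<in> carrier G. \<exists>w \<in> carrier G.
       inv x = e [^] a \<otimes> z [^] m \<and> inv y = g [^] a \<otimes> w [^] m" if m: "m > 0" for m :: int
  proof -
    obtain a z w where
      "z \<in> carrier G" "w \<in> carrier G" "x = e [^] (a::int) \<otimes> z [^] m" "y = g [^] a \<otimes> w [^] m"
      using endo_value_approx[OF xy m] by metis
    then show ?thesis using g
      by (intro exI[of _ "- a"] bexI[of _ "inv z"] bexI[of _ "inv w"])
        (simp_all add: int_pow_neg int_pow_inv inv_mult)
  qed
  ultimately show ?thesis
    unfolding endo_value_def using c nk(1) by (auto intro!: exI)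
qed

text \<open>
  By the second condition \<open>y\<close> is torsion, by the third one it lies in every \<open>MG\<close>.
\<close>
lemma endo_value_one:
  assumes g: "g \<in> carrier G" and y: "endo_value g \<one> y"
  shows "y = \<one>"
proof -
  have yc: "y \<in> carrier G" using y by (simp add: endo_value_def)
  obtain n k :: int where n: "n > 0" and "\<one> [^] n = e [^] k" and yk: "y [^] n = g [^] k"
    using endo_value_multiple[OF y] by metis
  then have "k = 0" using e_free by simp
  then have yn: "y [^] n = \<one>" using yk by simp
  obtain M :: int where M: "M > 0" "\<And>w. w \<in> carrier G \<Longrightarrow> (w [^] M) [^] n = \<one> \<Longrightarrow> w [^] M = \<one>"
    using torsion_separated[OF n] by blast
  obtain a z w where z: "z \<in> carrier G" "w \<in> carrier G" "\<one> = e [^] (a::int) \<otimes> z [^] M"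
    "y = g [^] a \<otimes> w [^] M"
    using endo_value_approx[OF y M(1)] by metis
  obtain b v where v: "v \<in> carrier G" "g = e [^] (b::int) \<otimes> v [^] M"
    using divisible_mod_e[OF g M(1)] by blast
  have ea: "e [^] a = inv z [^] M"
    using z by (metis e_closed int_pow_closed int_pow_inv inv_equality)
  have "g [^] a = (e [^] a) [^] b \<otimes> (v [^] a) [^] M"
    using v by (simp add: int_pow_distrib int_pow_pow mult.commute)
  also have "\<dots> = (inv z [^] b \<otimes> v [^] a) [^] M"
    using v z ea by (simp add: int_pow_distrib int_pow_pow mult.commute)
  finally have "y = (inv z [^] b \<otimes> v [^] a \<otimes> w) [^] M"
    using z v by (simp add: int_pow_distrib)
  then show ?thesis using M(2)[of "inv z [^] b \<otimes> v [^] a \<otimes> w"] yn z v by simp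
qed

lemma endo_value_unique:
  assumes g: "g \<in> carrier G" and "endo_value g x y" "endo_value g x y'"
  shows "y = y'"
proof -
  have c: "x \<in> carrier G" "y \<in> carrier G" "y' \<in> carrier G"
    using assms by (simp_all add: endo_value_def)
  have "endo_value g (x \<otimes> inv x) (y \<otimes> inv y')"
    using assms by (simp add: endo_value_mult endo_value_inv)
  then have "y \<otimes> inv y' = \<one>" using endo_value_one g c by simp
  then show ?thesis using c by (metis inv_closed inv_equality inv_inv)
qed

text \<open>
  Modulo each \<open>Q\<close> there is a candidate \<open>y\<close> that satisfies the equation \<open>n y = k g\<close> exactly. Two
  candidates for moduli divisible by \<open>M\<close> differ by an \<open>n\<close>-torsion element of \<open>MG\<close>, so they
  coincide when \<open>M\<close> is chosen by \<open>torsion_separated\<close>. The candidate for \<open>M\<close> therefore works for all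
  moduli at once.
\<close>
lemma endo_value_exists:
  assumes g: "g \<in> carrier G" and x: "x \<in> carrier G"
  shows "\<exists>y. endo_value g x y"
proof -
  obtain n k :: int where n: "n > 0" and xn: "x [^] n = e [^] k"
    using torsion_mod_e[OF x] by blast
  obtain M :: int where M: "M > 0" "\<And>w. w \<in> carrier G \<Longrightarrow> (w [^] M) [^] n = \<one> \<Longrightarrow> w [^] M = \<one>"
    using torsion_separated[OF n] by blast
  have approx: "\<exists>y \<in> carrier G. y [^] n = g [^] k \<and> (\<exists>a::int. \<exists>z \<in> carrier G. \<exists>w \<in> carrier G.
       x = e [^] a \<otimes> z [^] Q \<and> y = g [^] a \<otimes> w [^] Q)" if Q: "Q > 0" for Q :: int
  proof -
    obtain a z where z: "z \<in> carrier G" "x = e [^] (a::int) \<otimes> z [^] Q"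
      using divisible_mod_e[OF x Q] by blast
    have nQ: "n * Q > 0" using n Q by simp
    (* Dividing by n * Q instead of Q leaves a factor n with which n y = k g can be met exactly. *)
    obtain b v where v: "v \<in> carrier G" "g = e [^] (b::int) \<otimes> v [^] (n * Q)"
      using divisible_mod_e[OF g nQ] by blast
    have "e [^] k = e [^] (a * n) \<otimes> z [^] (n * Q)"
      using z xn[symmetric] by (simp add: int_pow_distrib int_pow_pow mult.commute)
    then have ek: "e [^] (k - a * n) = z [^] (n * Q)"
      using z inv_solve_left'[of "z [^] (n * Q)" "e [^] (a * n)" "e [^] k"]
      by (simp add: int_pow_diff m_comm)
    define w where "w = z [^] b \<otimes> v [^] (k - a * n)"
    have wc: "w \<in> carrier G" using z v by (simp add: w_def)
    have "g [^] (k - a * n) = (e [^] (k - a * n)) [^] b \<otimes> v [^] ((k - a * n) * (n * Q))"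
      using v by (simp add: int_pow_distrib int_pow_pow mult.commute)
    also have "\<dots> = (w [^] Q) [^] n"
      using v z ek by (simp add: w_def int_pow_distrib int_pow_pow mult_ac)
    finally have gw: "g [^] (k - a * n) = (w [^] Q) [^] n" .
    have "(g [^] a \<otimes> w [^] Q) [^] n = g [^] (a * n) \<otimes> g [^] (k - a * n)"
      using g wc by (simp add: int_pow_distrib int_pow_pow gw)
    also have "\<dots> = g [^] k"
      using g by (simp flip: int_pow_mult)
    finally have "(g [^] a \<otimes> w [^] Q) [^] n = g [^] k" .
    then show ?thesis using g z wc by blast
  qed
  obtain y a z w where y: "y \<in> carrier G" "y [^] n = g [^] k" and z: "z \<in> carrier G" "w \<in> carrier G"
     "x = e [^] (a::int) \<otimes> z [^] M" "y = g [^] a \<otimes> w [^] M"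
    using approx[OF M(1)] by metis
  have "\<exists>a::int. \<exists>z \<in> carrier G. \<exists>w \<in> carrier G.
       x = e [^] a \<otimes> z [^] m \<and> y = g [^] a \<otimes> w [^] m" if m: "m > 0" for m :: int
  proof -
    have Mm: "M * m > 0" using M m by simp
    obtain y' a' z' w' where y': "y' \<in> carrier G" "y' [^] n = g [^] k"
      and z': "z' \<in> carrier G" "w' \<in> carrier G"
        "x = e [^] (a'::int) \<otimes> z' [^] (M * m)" "y' = g [^] a' \<otimes> w' [^] (M * m)"
      using approx[OF Mm] by metis
    obtain b v where v: "v \<in> carrier G" "g = e [^] (b::int) \<otimes> v [^] M"
      using divisible_mod_e[OF g M(1)] by blast
    have "e [^] a' \<otimes> (z' [^] m) [^] M = e [^] a \<otimes> z [^] M"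
      using z z' by (simp add: int_pow_pow mult.commute)
    then have "inv (e [^] a) \<otimes> e [^] a' = z [^] M \<otimes> inv ((z' [^] m) [^] M)"
      using z z' by (intro mult_inv_exchange) simp_all
    then have ed: "e [^] (a' - a) = (z \<otimes> inv (z' [^] m)) [^] M"
      using z z' by (simp add: int_pow_diff int_pow_distrib int_pow_inv m_comm)
    define u where "u = (z \<otimes> inv (z' [^] m)) [^] b \<otimes> v [^] (a' - a)"
    have uc: "u \<in> carrier G" using z z' v by (simp add: u_def)
    have "g [^] (a' - a) = (e [^] (a' - a)) [^] b \<otimes> v [^] ((a' - a) * M)"
      using v by (simp add: int_pow_distrib int_pow_pow mult.commute)
    also have "\<dots> = u [^] M"
      unfolding ed using v z z' by (simp add: u_def int_pow_distrib int_pow_pow mult_ac)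
    finally have gu: "g [^] a' \<otimes> inv (g [^] a) = u [^] M" using g by (simp add: int_pow_diff)
    have "y' \<otimes> inv y = (g [^] a' \<otimes> inv (g [^] a)) \<otimes> ((w' [^] m) [^] M \<otimes> inv (w [^] M))"
      using z z' g by (simp add: inv_mult int_pow_pow mult.commute m_swap)
    also have "\<dots> = (u \<otimes> (w' [^] m \<otimes> inv w)) [^] M"
      unfolding gu using z z' uc by (simp add: int_pow_distrib int_pow_inv)
    finally have yy: "y' \<otimes> inv y = (u \<otimes> (w' [^] m \<otimes> inv w)) [^] M" .
    have "(y' \<otimes> inv y) [^] n = \<one>"
      using y y' g by (simp add: int_pow_distrib int_pow_inv)
    then have "y' \<otimes> inv y = \<one>"
      using M(2)[of "u \<otimes> (w' [^] m \<otimes> inv w)"] yy uc z z' by simp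
    then have "y = y'" using y y' by (metis inv_closed inv_equality inv_inv)
    then show ?thesis
      using z' by (intro exI[of _ a'] bexI[of _ "z' [^] M"] bexI[of _ "w' [^] M"])
        (simp_all add: int_pow_pow)
  qed
  then show ?thesis using x y n xn unfolding endo_value_def by blast
qed

lemma endomorphism_exists:
  assumes g: "g \<in> carrier G"
  shows "\<exists>f \<in> hom G G. f e = g"
proof -
  define f where "f x = (THE y. endo_value g x y)" for x
  have f: "endo_value g x (f x)" if "x \<in> carrier G" for x
    unfolding f_def using endo_value_exists[OF g that] endo_value_unique[OF g] by (metis theI)
  have "f \<in> hom G G"
  proof (rule homI)
    fix x y assume xy: "x \<in> carrier G" "y \<in> carrier G"
    then show "f (x \<otimes> y) = f x \<otimes> f y"
      using endo_value_unique[OF g f endo_value_mult[OF g f f]] by simp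
  qed (use f in \<open>simp add: endo_value_def\<close>)
  moreover have "f e = g"
    using endo_value_unique[OF g f endo_value_e[OF g]] by simp
  ultimately show ?thesis by blast
qed

lemma unital_multiplication_exists:
  "\<exists>\<nu>. multiplication_on G \<nu> \<and> (\<forall>g \<in> carrier G. \<nu> g e = g)"
proof -
  obtain \<nu> where \<nu>: "\<And>g. g \<in> carrier G \<Longrightarrow> \<nu> g \<in> hom G G" "\<And>g. g \<in> carrier G \<Longrightarrow> \<nu> g e = g"
    using endomorphism_exists by metis
  have "\<nu> (g \<otimes> h) x = \<nu> g x \<otimes> \<nu> h x"
    if "g \<in> carrier G" "h \<in> carrier G" "x \<in> carrier G" for g h x
    by (rule hom_ext[of "\<nu> (g \<otimes> h)" "\<lambda>x. \<nu> g x \<otimes> \<nu> h x"]) (use that \<nu> in \<open>auto intro: hom_mult_hom\<close>)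
  then have "multiplication_on G \<nu>"
    unfolding multiplication_on_def using \<nu> by (auto intro!: homI intro: hom_in_carrier[OF \<nu>(1)])
  then show ?thesis using \<nu> by blast
qed


section \<open>Multiplications on a group with a basis element\<close>

lemma products_torsion:
  assumes \<mu>: "multiplication_on G \<mu>" and m: "\<mu> e e [^] (m::int) = \<one>"
    and x: "x \<in> carrier G" and y: "y \<in> carrier G"
  shows "\<mu> x y [^] m = \<one>"
proof -
  have h: "(\<lambda>y. \<mu> x y) \<in> hom G G" "(\<lambda>y. \<mu> y x) \<in> hom G G" if "x \<in> carrier G" for x
    using \<mu> that unfolding multiplication_on_def by blast+
  have "\<mu> x e [^] m = \<one>"
    using hom_trivial[OF hom_pow_hom[OF h(2)[OF e_closed]] m x] .
  then show ?thesis
    using hom_trivial[OF hom_pow_hom[OF h(1)[OF x]] _ y] by blast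
qed

text \<open>
  Every endomorphism has the form \<open>x \<mapsto> a x + n (g \<times> x)\<close>, and such maps preserve ideals.
\<close>
lemma FI_ring_if_nontorsion:
  assumes \<mu>: "multiplication_on G \<mu>" and nt: "\<mu> e e \<notin> torsion_part G"
  shows "FI_ring G \<mu>"
  unfolding FI_ring_def fully_invariant_def
proof (intro allI impI conjI ballI)
  have h: "(\<lambda>y. \<mu> x y) \<in> hom G G" "(\<lambda>y. \<mu> y x) \<in> hom G G" if "x \<in> carrier G" for x
    using \<mu> that unfolding multiplication_on_def by blast+
  have ee: "\<mu> e e \<in> carrier G" by (rule hom_in_carrier[OF h(1)[OF e_closed] e_closed])
  obtain n k :: int where n: "n > 0" and nk: "\<mu> e e [^] n = e [^] k"
    using torsion_mod_e[OF ee] by blast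
  have "k \<noteq> 0"
  proof
    assume "k = 0"
    then have "\<mu> e e [^] nat n = \<one>" using n nk int_pow_int[of G "\<mu> e e" "nat n"] by simp
    moreover have "nat n > 0" using n by simp
    ultimately have "\<mu> e e \<in> torsion_part G" using ee unfolding torsion_part_def by blast
    then show False using nt by simp
  qed
  have scale: "\<mu> y e [^] n = y [^] k" if "y \<in> carrier G" for y
    using hom_ext[OF hom_pow_hom[OF h(2)[OF e_closed]] hom_pow_hom[OF id_hom] nk that] .
  fix I
  assume I: "ideal_of G \<mu> I"
  then show sI: "subgroup I G" by (simp add: ideal_of_def)
  fix \<phi> assume \<phi>: "\<phi> \<in> hom G G"
  have \<phi>e: "\<phi> e \<in> carrier G" using \<phi> by (simp add: hom_in_carrier)
  have "\<bar>k\<bar> > 0" using \<open>k \<noteq> 0\<close> by simp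
  then obtain a g where g: "g \<in> carrier G" "\<phi> e = e [^] (a::int) \<otimes> g [^] \<bar>k\<bar>"
    using divisible_mod_e[OF \<phi>e] by blast
  (* g is a |k|-fold divisor; the sign is absorbed so that k itself can be used. *)
  define g' where "g' = g [^] sgn k"
  have g'c: "g' \<in> carrier G" using g by (simp add: g'_def)
  have "g [^] \<bar>k\<bar> = g' [^] k"
    using g by (simp add: g'_def int_pow_pow sgn_mult_self_eq abs_sgn mult.commute)
  then have "\<phi> e = e [^] a \<otimes> \<mu> g' e [^] n" using g scale[OF g'c] by simp
  then have \<phi>x: "\<phi> x = x [^] a \<otimes> \<mu> g' x [^] n" if "x \<in> carrier G" for x
    using hom_ext[OF \<phi> hom_mult_hom[OF hom_pow_hom[OF id_hom] hom_pow_hom[OF h(1)[OF g'c]]] _ that]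
    by blast
  show "\<phi> ` I \<subseteq> I"
  proof
    fix y assume "y \<in> \<phi> ` I"
    then obtain x where x: "x \<in> I" "y = \<phi> x" by blast
    have "\<mu> g' x \<in> I" using I x g'c by (simp add: ideal_of_def)
    then have "x [^] a \<otimes> \<mu> g' x [^] n \<in> I"
      using sI x by (simp add: subgroup_int_pow_closed subgroup.m_closed)
    then show "y \<in> I" using \<phi>x x sI by (simp add: subgroup.mem_carrier)
  qed
qed

text \<open>
  All products with multiples of \<open>m\<close> vanish, so \<open>\<int>me\<close> is an ideal; being absolute, it is also an ideal for a
  multiplication with right unit \<open>e\<close>, which forces \<open>mG \<subseteq> \<int>me\<close>.
\<close>
lemma generated_by_e_if_AI_ring:
  assumes \<mu>: "multiplication_on G \<mu>" and AI: "AI_ring G \<mu>"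
    and m: "m > 0" "\<mu> e e [^] (m::int) = \<one>"
  shows "carrier G = range (\<lambda>k::int. e [^] k)"
proof
  have h: "(\<lambda>y. \<mu> x y) \<in> hom G G" "(\<lambda>y. \<mu> y x) \<in> hom G G" if "x \<in> carrier G" for x
    using \<mu> that unfolding multiplication_on_def by blast+
  define I where "I = range (\<lambda>k::int. (e [^] m) [^] k)"
  have I: "I = generate G {e [^] m}" by (simp add: I_def generate_pow full_SetCompr_eq)
  have sI: "subgroup I G" unfolding I by (rule generate_is_subgroup) simp
  have "ideal_of G \<mu> I"
    unfolding ideal_of_def
  proof (intro conjI ballI)
    fix b x assume b: "b \<in> I" and x: "x \<in> carrier G"
    obtain k :: int where k: "b = (e [^] k) [^] m"
      using b by (auto simp: I_def int_pow_pow mult.commute)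
    have "\<mu> b x = \<mu> (e [^] k) x [^] m"
      unfolding k by (rule hom_int_pow[OF h(2)[OF x]]) (simp_all add: is_group)
    then have "\<mu> b x = \<one>" using products_torsion[OF \<mu> m(2)] x by simp
    then show "\<mu> b x \<in> I" using sI by (simp add: subgroup.one_closed)
    have "\<mu> x b = \<mu> x (e [^] k) [^] m"
      unfolding k by (rule hom_int_pow[OF h(1)[OF x]]) (simp_all add: is_group)
    then have "\<mu> x b = \<one>" using products_torsion[OF \<mu> m(2)] x by simp
    then show "\<mu> x b \<in> I" using sI by (simp add: subgroup.one_closed)
  qed (fact sI)
  then have abs: "absolute_ideal G I" using AI by (simp add: AI_ring_def)
  obtain \<nu> where \<nu>: "multiplication_on G \<nu>" "\<And>g. g \<in> carrier G \<Longrightarrow> \<nu> g e = g"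
    using unital_multiplication_exists by blast
  have emI: "e [^] m \<in> I" unfolding I by (simp add: generate.incl)
  show "carrier G \<subseteq> range (\<lambda>k::int. e [^] k)"
  proof
    fix x assume x: "x \<in> carrier G"
    obtain a g where g: "g \<in> carrier G" "x = e [^] (a::int) \<otimes> g [^] m"
      using divisible_mod_e[OF x m(1)] by blast
    have \<nu>g: "(\<lambda>y. \<nu> g y) \<in> hom G G" using \<nu>(1) g by (simp add: multiplication_on_def)
    have "\<nu> g (e [^] m) = \<nu> g e [^] m"
      by (rule hom_int_pow[OF \<nu>g]) (simp_all add: is_group)
    moreover have "\<nu> g (e [^] m) \<in> I"
      using abs \<nu>(1) emI g by (simp add: absolute_ideal_def ideal_of_def)
    ultimately have "g [^] m \<in> I" using \<nu>(2) g by simp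
    then obtain k :: int where "g [^] m = e [^] (m * k)"
      by (auto simp: I_def int_pow_pow)
    then have "x = e [^] (a + m * k)" using g by (simp add: int_pow_mult)
    then show "x \<in> range (\<lambda>k::int. e [^] k)" by blast
  qed
qed auto

text \<open>
  One integer \<open>m\<close> that kills \<open>e \<times> e\<close> kills all products.
\<close>
lemma torsion_iff_products_torsion:
  assumes \<mu>: "multiplication_on G \<mu>"
  shows "\<mu> e e \<in> torsion_part G \<longleftrightarrow> product_subgroup G \<mu> \<subseteq> torsion_part G"
proof
  assume "\<mu> e e \<in> torsion_part G"
  then obtain n :: nat where n: "n > 0" "\<mu> e e [^] int n = \<one>"
    by (auto simp: torsion_part_def int_pow_int)
  have c: "\<mu> x y \<in> carrier G" if "x \<in> carrier G" "y \<in> carrier G" for x y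
    using \<mu> that unfolding multiplication_on_def by (blast intro: hom_in_carrier)
  have "subgroup {x \<in> carrier G. x [^] int n = \<one>} G"
    by (rule subgroupI) (auto simp: int_pow_inv int_pow_distrib intro: exI[of _ "\<one>"])
  then have "product_subgroup G \<mu> \<subseteq> {x \<in> carrier G. x [^] int n = \<one>}"
    unfolding product_subgroup_def using products_torsion[OF \<mu> n(2)] c
    by (intro generate_subgroup_incl) auto
  then show "product_subgroup G \<mu> \<subseteq> torsion_part G"
    using n(1) by (auto simp: torsion_part_def int_pow_int)
next
  assume "product_subgroup G \<mu> \<subseteq> torsion_part G"
  moreover have "\<mu> e e \<in> product_subgroup G \<mu>"
    unfolding product_subgroup_def by (rule generate.incl) auto
  ultimately show "\<mu> e e \<in> torsion_part G" by blast
qed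

end

text \<open>
  Left and right multiplications of any ring on \<open>G\<close> are endomorphisms of \<open>G\<close>.
\<close>
lemma FI_ring_imp_AI_ring:
  assumes \<mu>: "multiplication_on G \<mu>" and FI: "FI_ring G \<mu>"
  shows "AI_ring G \<mu>"
  unfolding AI_ring_def absolute_ideal_def
proof (intro allI impI conjI)
  fix I assume "ideal_of G \<mu> I"
  then have I: "fully_invariant G I" using FI by (simp add: FI_ring_def)
  then show sI: "subgroup I G" by (simp add: fully_invariant_def)
  fix \<nu> assume \<nu>: "multiplication_on G \<nu>"
  show "ideal_of G \<nu> I"
    unfolding ideal_of_def
  proof (intro conjI ballI)
    fix a x assume a: "a \<in> I" and x: "x \<in> carrier G"
    have "(\<lambda>y. \<nu> x y) \<in> hom G G" "(\<lambda>y. \<nu> y x) \<in> hom G G"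
      using \<nu> x unfolding multiplication_on_def by blast+
    then have "(\<lambda>y. \<nu> x y) ` I \<subseteq> I" "(\<lambda>y. \<nu> y x) ` I \<subseteq> I"
      using I unfolding fully_invariant_def by metis+
    then show "\<nu> a x \<in> I" "\<nu> x a \<in> I"
      using a by (simp_all add: image_subset_iff)
  qed (fact sI)
qed

text \<open>
  Every endomorphism of a cyclic group is a power map.
\<close>
lemma (in group) cyclic_group_fully_invariant:
  assumes "cyclic_group G" and I: "subgroup I G"
  shows "fully_invariant G I"
  unfolding fully_invariant_def
proof (intro conjI ballI)
  fix \<phi> assume \<phi>: "\<phi> \<in> hom G G"
  obtain c where c: "c \<in> carrier G" "carrier G = range (\<lambda>n::int. c [^] n)"
    using assms(1) cyclic_group by blast
  obtain a :: int where a: "\<phi> c = c [^] a" using \<phi> c by (metis hom_in_carrier imageE)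
  show "\<phi> ` I \<subseteq> I"
  proof
    fix y assume "y \<in> \<phi> ` I"
    then obtain x where x: "x \<in> I" "y = \<phi> x" by blast
    then have "x \<in> carrier G" using I by (simp add: subgroup.mem_carrier)
    then obtain k :: int where k: "x = c [^] k" using c(2) by auto
    have "y = \<phi> c [^] k" unfolding x k by (rule hom_int_pow[OF \<phi> c(1)]) (simp_all add: is_group)
    then have "y = x [^] a" using a k c by (simp add: int_pow_pow mult.commute)
    then show "y \<in> I" using I x by (simp add: subgroup_int_pow_closed)
  qed
qed (fact I)

lemma (in group) integer_group_iso_if_infinite_cyclic:
  assumes c: "c \<in> carrier G" and gen: "carrier G \<subseteq> range (\<lambda>k::int. c [^] k)"
    and free: "\<And>k::int. c [^] k = \<one> \<Longrightarrow> k = 0"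
  shows "integer_group \<cong> G"
proof (rule is_isoI, unfold iso_def, intro CollectI conjI)
  show "(\<lambda>k::int. c [^] k) \<in> hom integer_group G"
    using c by (rule hom_integer_group_pow)
  have "inj (\<lambda>k::int. c [^] k)"
  proof (rule injI)
    fix k l :: int assume "c [^] k = c [^] l"
    then have "c [^] (k - l) = \<one>" using c by (simp add: int_pow_diff)
    then show "k = l" using free[of "k - l"] by simp
  qed
  moreover have "carrier G = range (\<lambda>k::int. c [^] k)" using gen c by auto
  ultimately show "bij_betw (\<lambda>k::int. c [^] k) (carrier integer_group) (carrier G)"
    by (simp add: bij_betw_def)
qed

lemma qd_rank_oneI:
  fixes G :: "('a, 'b) monoid_scheme" (structure)
  assumes "quotient_divisible G" and "qd_basis G {e}"
  shows "qd_rank_one G e"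
proof -
  interpret comm_group G using assms(1) by (simp add: quotient_divisible_def)
  have e: "e \<in> carrier G" and ind: "indep G {e}" using assms(2) by (auto simp: qd_basis_def indep_def)
  define H where "H = generate G {e}"
  have H: "H = range (\<lambda>k::int. e [^] k)" using e by (simp add: H_def generate_pow full_SetCompr_eq)
  have sH: "subgroup H G" unfolding H_def using e by (simp add: generate_is_subgroup)
  interpret N: normal H G using sH by (rule subgroup_imp_normal)
  interpret Q: group "G Mod H" by (rule N.factorgroup_is_group)
  have proj: "(\<lambda>x. H #> x) \<in> hom G (G Mod H)" by (rule N.r_coset_hom_Mod)
  have car: "carrier (G Mod H) = (\<lambda>x. H #> x) ` carrier G" by (rule carrier_FactGroup)
  have pw: "(H #> x) [^]\<^bsub>G Mod H\<^esub> (n::nat) = H #> (x [^] n)" if "x \<in> carrier G" for x n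
    using hom_nat_pow[OF proj that is_group Q.is_group] by simp
  show ?thesis
  proof (unfold_locales)
    show "e \<in> carrier G" by (fact e)
  next
    fix k :: int assume "e [^] k = \<one>"
    then show "k = 0" using ind e unfolding indep_def by (auto dest: spec[of _ "\<lambda>_. k"])
  next
    fix x assume x: "x \<in> carrier G"
    have "H #> x \<in> torsion_part (G Mod H)"
      using assms(2) x by (auto simp: qd_basis_def torsion_group_def H_def[symmetric] car)
    then obtain n :: nat where "n > 0" "H #> (x [^] n) = H"
      using x pw by (auto simp: torsion_part_def)
    then have "x [^] n \<in> H" using x sH by (metis nat_pow_closed rcos_self)
    then obtain k :: int where "x [^] int n = e [^] k" by (auto simp: H int_pow_int)
    then show "\<exists>(n::int) (k::int). n > 0 \<and> x [^] n = e [^] k"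
      using \<open>n > 0\<close> by (intro exI[of _ "int n"] exI[of _ k]) simp
  next
    fix x and n :: int assume x: "x \<in> carrier G" and n: "n > 0"
    have "H #> x \<in> carrier (G Mod H)" using x by (simp add: car)
    moreover have "divisible_group (G Mod H)" using assms(2) by (simp add: qd_basis_def H_def)
    moreover have "nat n > 0" using n by simp
    ultimately obtain Z where "Z \<in> carrier (G Mod H)" "Z [^]\<^bsub>G Mod H\<^esub> nat n = H #> x"
      unfolding divisible_group_def by blast
    then obtain z where z: "z \<in> carrier G" "H #> (z [^] nat n) = H #> x"
      using pw unfolding car by blast
    then have "x \<in> H #> (z [^] nat n)" using x sH by (metis rcos_self)
    then obtain a :: int where "x = e [^] a \<otimes> z [^] nat n" by (auto simp: r_coset_def H)
    then show "\<exists>a::int. \<exists>z\<in>carrier G. x = e [^] a \<otimes> z [^] n"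
      using z n by (metis int_nat_eq int_pow_int less_imp_le)
  next
    fix D
    assume D: "subgroup D G" and dv: "\<And>x n. x \<in> D \<Longrightarrow> 0 < n \<Longrightarrow> \<exists>y\<in>D. y [^] (n::int) = x"
      and tr: "\<And>x. x \<in> D \<Longrightarrow> \<exists>n>0::int. x [^] n = \<one>"
    have "divisible_group (G\<lparr>carrier := D\<rparr>)"
      using dv[of _ "int _"] by (auto simp: divisible_group_def int_pow_int simp flip: nat_pow_consistent)
    moreover have "torsion_group (G\<lparr>carrier := D\<rparr>)"
    proof -
      have "\<exists>n::nat. n > 0 \<and> x [^] n = \<one>" if x: "x \<in> D" for x
      proof -
        obtain n :: int where "n > 0" "x [^] n = \<one>" using tr[OF x] by blast
        then show ?thesis by (intro exI[of _ "nat n"]) (simp flip: int_pow_int)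
      qed
      then show ?thesis
        by (auto simp: torsion_group_def torsion_part_def simp flip: nat_pow_consistent)
    qed
    ultimately show "D = {\<one>}" using assms(1) D by (simp add: quotient_divisible_def)
  qed
qed

section \<open>The group whose cocharacteristic is infinite at every prime\<close>

lemma padic_coherent:
  fixes x :: "nat \<Rightarrow> int"
  assumes "\<And>n. x n \<in> {0..<int p ^ n} \<and> x (Suc n) mod int p ^ n = x n"
  shows "x (n + a) mod int p ^ n = x n"
proof (induction a)
  case 0
  then show ?case using assms[of n] by simp
next
  case (Suc a)
  have "x (n + Suc a) mod int p ^ n = x (Suc (n + a)) mod int p ^ (n + a) mod int p ^ n"
    by (simp add: mod_mod_cancel le_imp_power_dvd)
  also have "\<dots> = x (n + a) mod int p ^ n" using assms[of "n + a"] by simp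
  finally show ?case using Suc.IH by simp
qed

text \<open>
  A family of \<open>p\<close>-adic integers, one for each prime, which is the rational number \<open>K/N\<close> at every
  prime is the constant family of an integer: integrality at \<open>p\<close> shows that the \<open>p\<close>-part of \<open>N\<close>
  divides \<open>K\<close>, and \<open>\<int>\<^sub>p\<close> is torsion-free.
\<close>
lemma padic_family_integer:
  fixes u :: "nat \<Rightarrow> nat \<Rightarrow> int"
  assumes u: "\<And>p j. prime p \<Longrightarrow> u p j \<in> {0..<int p ^ j} \<and> u p (Suc j) mod int p ^ j = u p j"
    and N: "N > (0::nat)"
    and K: "\<And>p j. prime p \<Longrightarrow> int p ^ j dvd int N * u p j - K"
  shows "\<exists>q. \<forall>p j. prime p \<longrightarrow> u p j = q mod int p ^ j"
proof -
  have "N dvd nat \<bar>K\<bar>"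
  proof (cases "K = 0")
    case False
    show ?thesis
    proof (rule multiplicity_le_imp_dvd)
      fix p :: nat assume p: "prime p"
      let ?a = "multiplicity p N"
      have "int p ^ ?a dvd int N"
        by (metis multiplicity_dvd of_nat_dvd_iff of_nat_power)
      then have "int p ^ ?a dvd int N * u p ?a" by (rule dvd_mult2)
      then have "int p ^ ?a dvd int N * u p ?a - (int N * u p ?a - K)"
        using K[OF p] by (rule dvd_diff)
      then have "int p ^ ?a dvd K" by simp
      then have "p ^ ?a dvd nat \<bar>K\<bar>"
        by (simp add: nat_abs_dvd_iff flip: of_nat_dvd_iff)
      then show "?a \<le> multiplicity p (nat \<bar>K\<bar>)"
        using False p by (intro multiplicity_geI) (auto simp: prime_gt_0_nat not_prime_1 prime_nat_iff)
    qed (use N in simp)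
  qed simp
  then have "int N dvd K" by (metis dvd_abs_iff int_nat_eq abs_ge_zero of_nat_dvd_iff)
  then obtain q where q: "K = int N * q" by blast
  have "u p j = q mod int p ^ j" if p: "prime p" for p j
  proof -
    let ?a = "multiplicity p N"
    obtain N' where N': "N = p ^ ?a * N'" "\<not> p dvd N'"
      using multiplicity_decompose'[of N p] N p by (metis less_numeral_extra(3) not_prime_unit)
    have cop: "coprime (int p ^ j) (int N')"
      using p N'(2) by (simp add: prime_imp_coprime)
    (* Cancelling N costs the p-part of N, so the congruence is taken at level j + ?a. *)
    have "int p ^ (j + ?a) dvd int N * (u p (j + ?a) - q)"
      using K[OF p, of "j + ?a"] by (simp add: q right_diff_distrib)
    also have "int N = int p ^ ?a * int N'"
      by (subst N'(1)) simp
    finally have "int p ^ ?a * int p ^ j dvd int p ^ ?a * (int N' * (u p (j + ?a) - q))"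
      by (simp only: power_add mult_ac)
    then have "int p ^ j dvd int N' * (u p (j + ?a) - q)"
      using p by (simp add: prime_gt_0_nat)
    then have "int p ^ j dvd u p (j + ?a) - q"
      using cop by (simp add: coprime_dvd_mult_right_iff)
    then have "u p (j + ?a) mod int p ^ j = q mod int p ^ j"
      by (simp add: mod_eq_dvd_iff)
    then show ?thesis using padic_coherent[of "u p" p j ?a] u[OF p] by simp
  qed
  then show ?thesis by blast
qed

lemma padic_int_carrier:
  "x \<in> carrier (padic_int p) \<longleftrightarrow> (\<forall>n. x n \<in> {0..<int p ^ n} \<and> x (Suc n) mod int p ^ n = x n)"
  by (simp add: padic_int_def)

lemma padic_int_add: "x \<oplus>\<^bsub>padic_int p\<^esub> y = (\<lambda>n. (x n + y n) mod int p ^ n)"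
  by (simp add: padic_int_def)

lemma padic_int_zero: "\<zero>\<^bsub>padic_int p\<^esub> = (\<lambda>n. 0)"
  by (simp add: padic_int_def)

lemma padic_int_one: "\<one>\<^bsub>padic_int p\<^esub> = (\<lambda>n. 1 mod int p ^ n)"
  by (simp add: padic_int_def)

lemma mod_power_Suc_mod: "(a::int) mod p ^ Suc n mod p ^ n = a mod p ^ n"
  by (rule mod_mod_cancel) (simp add: le_imp_power_dvd)

lemma padic_int_add_closed:
  assumes "p > 0" "x \<in> carrier (padic_int p)" "y \<in> carrier (padic_int p)"
  shows "x \<oplus>\<^bsub>padic_int p\<^esub> y \<in> carrier (padic_int p)"
  unfolding padic_int_carrier padic_int_add mod_power_Suc_mod
proof (intro allI conjI)
  show "(x (Suc n) + y (Suc n)) mod int p ^ n = (x n + y n) mod int p ^ n" for n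
    using assms unfolding padic_int_carrier by (metis mod_add_eq)
qed (use assms(1) in simp)

lemma padic_int_of_int:
  assumes "p > 0"
  shows "(\<lambda>n. k mod int p ^ n) \<in> carrier (padic_int p)"
  using assms unfolding padic_int_carrier mod_power_Suc_mod by simp

lemma padic_int_uminus:
  assumes "p > 0" "x \<in> carrier (padic_int p)"
  shows "(\<lambda>n. - x n mod int p ^ n) \<in> carrier (padic_int p)"
  unfolding padic_int_carrier mod_power_Suc_mod
proof (intro allI conjI)
  show "- x (Suc n) mod int p ^ n = - x n mod int p ^ n" for n
    using assms unfolding padic_int_carrier by (metis mod_minus_eq)
qed (use assms(1) in simp)

lemma padic_add_group:
  assumes p: "p > 0"
  shows "group (add_monoid (padic_int p))"
proof (rule groupI, unfold monoid_record_simps)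
  show "\<zero>\<^bsub>padic_int p\<^esub> \<in> carrier (padic_int p)"
    using p by (simp add: padic_int_zero padic_int_carrier)
  show "x \<oplus>\<^bsub>padic_int p\<^esub> y \<oplus>\<^bsub>padic_int p\<^esub> z = x \<oplus>\<^bsub>padic_int p\<^esub> (y \<oplus>\<^bsub>padic_int p\<^esub> z)" for x y z
    by (simp add: padic_int_add mod_simps add.assoc)
  show "\<zero>\<^bsub>padic_int p\<^esub> \<oplus>\<^bsub>padic_int p\<^esub> x = x" if "x \<in> carrier (padic_int p)" for x
    using that by (simp add: padic_int_add padic_int_zero padic_int_carrier)
  show "\<exists>y \<in> carrier (padic_int p). y \<oplus>\<^bsub>padic_int p\<^esub> x = \<zero>\<^bsub>padic_int p\<^esub>"
    if "x \<in> carrier (padic_int p)" for x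
    using padic_int_uminus[OF p that]
    by (rule bexI[rotated]) (simp add: padic_int_add padic_int_zero mod_simps)
qed (use padic_int_add_closed[OF p] in simp)

lemma order_ideal_infinity: "order_ideal p \<infinity> = {\<zero>\<^bsub>padic_int p\<^esub>}"
  by (simp add: order_ideal_def)

text \<open>
  The quotient by the zero ideal consists of singletons, which makes the group \<open>Z_char\<close> below
  a product of copies of the \<open>p\<close>-adic integers.
\<close>
lemma padic_zero_coset:
  assumes "p > 0" "x \<in> carrier (padic_int p)"
  shows "{\<zero>\<^bsub>padic_int p\<^esub>} +>\<^bsub>padic_int p\<^esub> x = {x}"
  using assms by (simp add: a_r_coset_def' padic_int_add padic_int_zero padic_int_carrier)

lemma padic_cyclic_infinity:
  assumes p: "p > 0"
  shows "carrier (padic_cyclic p \<infinity>) = (\<lambda>x. {x}) ` carrier (padic_int p)"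
    and "{x} \<oplus>\<^bsub>padic_cyclic p \<infinity>\<^esub> {y} = {x \<oplus>\<^bsub>padic_int p\<^esub> y}"
    and "\<zero>\<^bsub>padic_cyclic p \<infinity>\<^esub> = {\<zero>\<^bsub>padic_int p\<^esub>}"
    and "\<one>\<^bsub>padic_cyclic p \<infinity>\<^esub> = {\<one>\<^bsub>padic_int p\<^esub>}"
  using padic_zero_coset[OF p] padic_int_of_int[OF p, of 1]
  by (auto simp: padic_cyclic_def order_ideal_infinity FactRing_def A_RCOSETS_def' set_add_def
      set_mult_def simp flip: padic_int_one)

lemma padic_cyclic_infinity_group:
  assumes p: "p > 0"
  shows "group (add_monoid (padic_cyclic p \<infinity>))"
proof -
  interpret P: group "add_monoid (padic_int p)" using p by (rule padic_add_group)
  note P = P.m_assoc[simplified] P.l_one[simplified] P.m_closed[simplified] P.one_closed[simplified]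
  show ?thesis
  proof (rule groupI, unfold monoid_record_simps)
    show "\<exists>y \<in> carrier (padic_cyclic p \<infinity>). y \<oplus>\<^bsub>padic_cyclic p \<infinity>\<^esub> x = \<zero>\<^bsub>padic_cyclic p \<infinity>\<^esub>"
      if "x \<in> carrier (padic_cyclic p \<infinity>)" for x
      using that P.l_inv_ex by (fastforce simp: padic_cyclic_infinity[OF p])
  qed (auto simp: padic_cyclic_infinity[OF p] P)
qed

lemma Z_char_infinity_group: "group (Z_char (\<lambda>p. \<infinity>))"
  unfolding Z_char_def
  by (intro product_group padic_cyclic_infinity_group) (simp add: prime_gt_0_nat)

text \<open>
  The residue modulo \<open>p ^ j\<close> of the \<open>p\<close>-component of \<open>x\<close>; \<open>the_elem\<close> strips the singleton.
\<close>
definition padic_coord :: "nat \<Rightarrow> nat \<Rightarrow> (nat \<Rightarrow> (nat \<Rightarrow> int) set) \<Rightarrow> int"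
  where "padic_coord p j x = the_elem (x p) j"

lemma padic_coord:
  assumes x: "x \<in> carrier (Z_char (\<lambda>p. \<infinity>))" and p: "prime p"
  shows "x p = {\<lambda>j. padic_coord p j x}"
    and "(\<lambda>j. padic_coord p j x) \<in> carrier (padic_int p)"
proof -
  have "x p \<in> carrier (padic_cyclic p \<infinity>)"
    using x p by (auto simp: Z_char_def PiE_iff)
  then obtain u where "u \<in> carrier (padic_int p)" "x p = {u}"
    using padic_cyclic_infinity(1)[of p] p by (auto simp: prime_gt_0_nat)
  then show "x p = {\<lambda>j. padic_coord p j x}"
    and "(\<lambda>j. padic_coord p j x) \<in> carrier (padic_int p)"
    by (simp_all add: padic_coord_def)
qed

lemma padic_coord_range:
  assumes "x \<in> carrier (Z_char (\<lambda>p. \<infinity>))" and "prime p"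
  shows "padic_coord p j x \<in> {0..<int p ^ j}
    \<and> padic_coord p (Suc j) x mod int p ^ j = padic_coord p j x"
  using padic_coord(2)[OF assms] unfolding padic_int_carrier by blast

lemma Z_char_infinity_eqI:
  assumes x: "x \<in> carrier (Z_char (\<lambda>p. \<infinity>))" and y: "y \<in> carrier (Z_char (\<lambda>p. \<infinity>))"
    and eq: "\<And>p j. prime p \<Longrightarrow> padic_coord p j x = padic_coord p j y"
  shows "x = y"
proof (rule PiE_ext)
  show "x \<in> (\<Pi>\<^sub>E p\<in>{p. prime p}. carrier (padic_cyclic p \<infinity>))"
    and "y \<in> (\<Pi>\<^sub>E p\<in>{p. prime p}. carrier (padic_cyclic p \<infinity>))"
    using x y by (simp_all add: Z_char_def)
  show "x p = y p" if "p \<in> {p. prime p}" for p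
    using that padic_coord(1)[OF x, of p] padic_coord(1)[OF y, of p] eq by simp
qed

lemma padic_coord_hom:
  assumes p: "prime p"
  shows "padic_coord p j \<in> hom (Z_char (\<lambda>p. \<infinity>)) (integer_mod_group (p ^ j))"
proof (rule homI)
  fix x y
  assume x: "x \<in> carrier (Z_char (\<lambda>p. \<infinity>))" and y: "y \<in> carrier (Z_char (\<lambda>p. \<infinity>))"
  show "padic_coord p j x \<in> carrier (integer_mod_group (p ^ j))"
    using padic_coord_range[OF x p, of j] p
    by (simp add: carrier_integer_mod_group prime_gt_0_nat)
  have "(x \<otimes>\<^bsub>Z_char (\<lambda>p. \<infinity>)\<^esub> y) p = x p \<oplus>\<^bsub>padic_cyclic p \<infinity>\<^esub> y p"
    using p by (simp add: Z_char_def)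
  also have "\<dots> = {\<lambda>j. (padic_coord p j x + padic_coord p j y) mod int p ^ j}"
    unfolding padic_coord(1)[OF x p] padic_coord(1)[OF y p]
      padic_cyclic_infinity(2)[OF prime_gt_0_nat[OF p]] padic_int_add ..
  finally show "padic_coord p j (x \<otimes>\<^bsub>Z_char (\<lambda>p. \<infinity>)\<^esub> y) =
      padic_coord p j x \<otimes>\<^bsub>integer_mod_group (p ^ j)\<^esub> padic_coord p j y"
    unfolding padic_coord_def[of p j "x \<otimes>\<^bsub>Z_char (\<lambda>p. \<infinity>)\<^esub> y"] by simp
qed

lemma padic_coord_int_pow:
  assumes "prime p" "x \<in> carrier (Z_char (\<lambda>p. \<infinity>))"
  shows "padic_coord p j (x [^]\<^bsub>Z_char (\<lambda>p. \<infinity>)\<^esub> (k::int)) = k * padic_coord p j x mod int p ^ j"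
  using hom_int_pow[OF padic_coord_hom[OF assms(1)] assms(2) Z_char_infinity_group, of j k]
  by (simp add: int_pow_integer_mod_group)

lemma Z_char_gen_infinity:
  shows "Z_char_gen (\<lambda>p. \<infinity>) \<in> carrier (Z_char (\<lambda>p. \<infinity>))"
    and "prime p \<Longrightarrow> padic_coord p j (Z_char_gen (\<lambda>p. \<infinity>)) = 1 mod int p ^ j"
proof -
  have one: "\<one>\<^bsub>padic_cyclic p \<infinity>\<^esub> = {\<lambda>j. 1 mod int p ^ j}" if "prime p" for p
    using that by (simp add: padic_cyclic_infinity(4) prime_gt_0_nat padic_int_one)
  show "Z_char_gen (\<lambda>p. \<infinity>) \<in> carrier (Z_char (\<lambda>p. \<infinity>))"
    using one padic_int_of_int[of _ 1]
    by (auto simp: Z_char_gen_def Z_char_def padic_cyclic_infinity(1) prime_gt_0_nat)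
  show "padic_coord p j (Z_char_gen (\<lambda>p. \<infinity>)) = 1 mod int p ^ j" if "prime p"
    using one[OF that] that by (simp add: padic_coord_def Z_char_gen_def)
qed

lemma padic_coord_gen_pow:
  assumes "prime p"
  shows "padic_coord p j (Z_char_gen (\<lambda>p. \<infinity>) [^]\<^bsub>Z_char (\<lambda>p. \<infinity>)\<^esub> (k::int)) = k mod int p ^ j"
  using assms by (simp add: padic_coord_int_pow Z_char_gen_infinity mod_simps)

text \<open>
  An element \<open>x\<close> of the pure closure satisfies \<open>n x = k e + t\<close> with \<open>m t = 0\<close>, so \<open>(m n) x = (m k) e\<close>;
  componentwise this makes \<open>x\<close> a rational number, hence an integer.
\<close>
lemma carrier_nonzero_type_group_infinity:
  "carrier (nonzero_type_group (\<lambda>p. \<infinity>)) = generate (Z_char (\<lambda>p. \<infinity>)) {Z_char_gen (\<lambda>p. \<infinity>)}"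
proof -
  let ?Z = "Z_char (\<lambda>p. \<infinity>)" and ?g = "Z_char_gen (\<lambda>p. \<infinity>)"
  interpret Z: group ?Z by (rule Z_char_infinity_group)
  note g = Z_char_gen_infinity(1)
  have gen: "generate ?Z {?g} = range (\<lambda>k::int. ?g [^]\<^bsub>?Z\<^esub> k)"
    using Z.generate_pow[OF g] by (simp add: full_SetCompr_eq)
  show ?thesis
  proof (intro equalityI subsetI)
    fix x assume "x \<in> generate ?Z {?g}"
    moreover from this have x: "x \<in> carrier ?Z" using gen g by auto
    moreover have "\<one>\<^bsub>?Z\<^esub> \<in> torsion_part ?Z"
      unfolding torsion_part_def by (auto intro: exI[of _ 1])
    ultimately have "x \<otimes>\<^bsub>?Z\<^esub> \<one>\<^bsub>?Z\<^esub> \<in> generate ?Z {?g} <#>\<^bsub>?Z\<^esub> torsion_part ?Z"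
      unfolding set_mult_def by blast
    then have "x [^]\<^bsub>?Z\<^esub> (1::nat) \<in> generate ?Z {?g} <#>\<^bsub>?Z\<^esub> torsion_part ?Z"
      using x by simp
    then show "x \<in> carrier (nonzero_type_group (\<lambda>p. \<infinity>))"
      using x by (auto simp: nonzero_type_group_def intro!: exI[of _ "1::nat"])
  next
    fix x assume "x \<in> carrier (nonzero_type_group (\<lambda>p. \<infinity>))"
    then obtain n :: nat and a t where x: "x \<in> carrier ?Z" and n: "n > 0"
      and xn: "x [^]\<^bsub>?Z\<^esub> n = a \<otimes>\<^bsub>?Z\<^esub> t"
      and a: "a \<in> generate ?Z {?g}" and t: "t \<in> torsion_part ?Z"
      by (auto simp: nonzero_type_group_def set_mult_def)
    obtain k :: int where k: "a = ?g [^]\<^bsub>?Z\<^esub> k" using a gen by auto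
    obtain m :: nat where tc: "t \<in> carrier ?Z" and m: "m > 0" "t [^]\<^bsub>?Z\<^esub> m = \<one>\<^bsub>?Z\<^esub>"
      using t by (auto simp: torsion_part_def)
    have dvd: "int p ^ j dvd int (m * n) * padic_coord p j x - int m * k" if p: "prime p" for p j
    proof -
      have "int n * padic_coord p j x mod int p ^ j = padic_coord p j (x [^]\<^bsub>?Z\<^esub> int n)"
        using padic_coord_int_pow[OF p x, of j "int n"] by simp
      also have "\<dots> = padic_coord p j a \<otimes>\<^bsub>integer_mod_group (p ^ j)\<^esub> padic_coord p j t"
        unfolding int_pow_int xn using g tc k by (intro hom_mult[OF padic_coord_hom[OF p]]) auto
      also have "\<dots> = (k + padic_coord p j t) mod int p ^ j"
        using padic_coord_gen_pow[OF p, of j k] by (simp add: k mod_simps)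
      finally have "int p ^ j dvd int n * padic_coord p j x - (k + padic_coord p j t)"
        by (simp add: mod_eq_dvd_iff)
      then have 1: "int p ^ j dvd int m * (int n * padic_coord p j x - (k + padic_coord p j t))"
        by (rule dvd_mult)
      have "int m * padic_coord p j t mod int p ^ j = padic_coord p j (t [^]\<^bsub>?Z\<^esub> int m)"
        using padic_coord_int_pow[OF p tc, of j "int m"] by simp
      also have "\<dots> = \<one>\<^bsub>integer_mod_group (p ^ j)\<^esub>"
        unfolding int_pow_int m(2) by (rule hom_one[OF padic_coord_hom[OF p]]) simp_all
      finally have "int p ^ j dvd int m * padic_coord p j t" by (simp add: dvd_eq_mod_eq_0)
      from dvd_add[OF 1 this] show ?thesis by (simp add: algebra_simps)
    qed
    have "m * n > 0" using m n by simp
    from padic_family_integer[of "\<lambda>p j. padic_coord p j x", OF padic_coord_range[OF x] this dvd]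
    obtain q where q: "\<And>p j. prime p \<Longrightarrow> padic_coord p j x = q mod int p ^ j" by blast
    have "x = ?g [^]\<^bsub>?Z\<^esub> q"
      using x g q padic_coord_gen_pow by (intro Z_char_infinity_eqI) auto
    then show "x \<in> generate ?Z {?g}" using gen by blast
  qed
qed

lemma nonzero_type_group_infinity:
  "group (nonzero_type_group (\<lambda>p. \<infinity>))" "integer_group \<cong> nonzero_type_group (\<lambda>p. \<infinity>)"
proof -
  let ?Z = "Z_char (\<lambda>p. \<infinity>)" and ?g = "Z_char_gen (\<lambda>p. \<infinity>)"
  let ?C = "nonzero_type_group (\<lambda>p. \<infinity>)"
  interpret Z: group ?Z by (rule Z_char_infinity_group)
  note g = Z_char_gen_infinity(1)
  have sub: "subgroup (generate ?Z {?g}) ?Z" using g by (simp add: Z.generate_is_subgroup)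
  have C: "?C = ?Z\<lparr>carrier := generate ?Z {?g}\<rparr>"
    using carrier_nonzero_type_group_infinity by (simp add: nonzero_type_group_def)
  show grp: "group ?C" unfolding C by (rule Z.subgroup_imp_group[OF sub])
  have gC: "?g \<in> generate ?Z {?g}" by (simp add: generate.incl)
  have pow: "?g [^]\<^bsub>?C\<^esub> k = ?g [^]\<^bsub>?Z\<^esub> k" for k :: int
    unfolding C by (rule Z.int_pow_consistent[OF sub gC, symmetric])
  show "integer_group \<cong> ?C"
  proof (rule group.integer_group_iso_if_infinite_cyclic[OF grp])
    show "?g \<in> carrier ?C" using gC by (simp add: C)
    show "carrier ?C \<subseteq> range (\<lambda>k::int. ?g [^]\<^bsub>?C\<^esub> k)"
      using Z.generate_pow[OF g] by (auto simp: pow carrier_nonzero_type_group_infinity)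
    fix k :: int assume "?g [^]\<^bsub>?C\<^esub> k = \<one>\<^bsub>?C\<^esub>"
    then have "?g [^]\<^bsub>?Z\<^esub> k = ?g [^]\<^bsub>?Z\<^esub> (0::int)"
      unfolding pow by (simp add: nonzero_type_group_def)
    (* The component at the single prime 2 already shows that the generator has infinite order. *)
    then have "k mod 2 ^ j = 0" for j :: nat
      using padic_coord_gen_pow[of 2 j k] padic_coord_gen_pow[of 2 j 0] by simp
    then have "2 ^ nat \<bar>k\<bar> dvd k" by (simp add: dvd_eq_mod_eq_0)
    moreover have "\<bar>k\<bar> < 2 ^ nat \<bar>k\<bar>"
      using of_nat_less_two_power[of "nat \<bar>k\<bar>", where 'a = int] by simp
    ultimately show "k = 0" using dvd_imp_le_int[of k "2 ^ nat \<bar>k\<bar>"] by force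
  qed
qed

lemma has_cochar_infinity_iff:
  assumes "group G"
  shows "has_cochar G (\<lambda>p. \<infinity>) \<longleftrightarrow> G \<cong> integer_group"
proof -
  have "\<not> zero_type (\<lambda>p. \<infinity>)" unfolding zero_type_def using two_is_prime_nat by blast
  then have "has_cochar G (\<lambda>p. \<infinity>) \<longleftrightarrow> G \<cong> nonzero_type_group (\<lambda>p. \<infinity>)"
    by (simp add: has_cochar_def)
  then show ?thesis
    using nonzero_type_group_infinity
    by (meson group.iso_sym group_integer_group iso_trans)
qed

theorem theorem3p4:
  fixes G :: "('a, 'b) monoid_scheme" and e :: 'a
  assumes "QD1 G" and "qd_basis G {e}"
  shows "(has_cochar G (\<lambda>p. \<infinity>) \<longrightarrow>
           (\<forall>\<mu>. multiplication_on G \<mu> \<longrightarrow> FI_ring G \<mu> \<and> AI_ring G \<mu>)) \<and>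
         (\<not> has_cochar G (\<lambda>p. \<infinity>) \<longrightarrow>
           (\<forall>\<mu>. multiplication_on G \<mu> \<longrightarrow>
              (FI_ring G \<mu> \<longleftrightarrow> AI_ring G \<mu>) \<and>
              (AI_ring G \<mu> \<longleftrightarrow> \<mu> e e \<notin> torsion_part G) \<and>
              (\<mu> e e \<notin> torsion_part G \<longleftrightarrow> \<not> product_subgroup G \<mu> \<subseteq> torsion_part G)))"
proof -
  interpret qd_rank_one G e
    using assms by (intro qd_rank_oneI) (simp_all add: QD1_def)
  show ?thesis
  proof (intro conjI impI allI)
    fix \<mu> assume "has_cochar G (\<lambda>p. \<infinity>)" and \<mu>: "multiplication_on G \<mu>"
    then have "cyclic_group G"
      using has_cochar_infinity_iff isomorphic_group_cyclicity is_group by fastforce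
    then show FI: "FI_ring G \<mu>"
      by (simp add: FI_ring_def ideal_of_def cyclic_group_fully_invariant)
    show "AI_ring G \<mu>" using \<mu> FI by (rule FI_ring_imp_AI_ring)
  next
    fix \<mu> assume nc: "\<not> has_cochar G (\<lambda>p. \<infinity>)" and \<mu>: "multiplication_on G \<mu>"
    have AI: "\<mu> e e \<notin> torsion_part G" if ai: "AI_ring G \<mu>"
    proof
      assume "\<mu> e e \<in> torsion_part G"
      then obtain m :: nat where "int m > 0" "\<mu> e e [^]\<^bsub>G\<^esub> int m = \<one>\<^bsub>G\<^esub>"
        by (auto simp: torsion_part_def int_pow_int)
      from generated_by_e_if_AI_ring[OF \<mu> ai this]
      have "integer_group \<cong> G"
        using e_free by (intro integer_group_iso_if_infinite_cyclic[of e]) auto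
      then show False
        using nc has_cochar_infinity_iff[OF is_group] group.iso_sym[OF group_integer_group] by blast
    qed
    show "FI_ring G \<mu> \<longleftrightarrow> AI_ring G \<mu>" "AI_ring G \<mu> \<longleftrightarrow> \<mu> e e \<notin> torsion_part G"
      using AI FI_ring_if_nontorsion[OF \<mu>] FI_ring_imp_AI_ring[OF \<mu>] by blast+
    show "\<mu> e e \<notin> torsion_part G \<longleftrightarrow> \<not> product_subgroup G \<mu> \<subseteq> torsion_part G"
      using torsion_iff_products_torsion[OF \<mu>] by blast
  qed
qed

end
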